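(* Let $\delta_1>0$ be the only positive solution $x$ of the equation $$\frac{x}{2}(1+x)^{3/2}(3+x)\left[1+(1+x)^{3/2}\right]=1.$$ If $0<\delta<\delta_1$, then the problem $$[(1+\delta y(x))y'(x)]'+2xy'(x)=0\quad (0<x<+\infty),\qquad y(0)=0,\qquad y(+\infty)=1$$ has a unique non-negative analytic solution $y:[0,+\infty)\to\mathbb{R}$.
   Context: The condition $y(+\infty)=1$ means $\lim_{x\to+\infty}y(x)=1$. "Analytic" means real analytic on $[0,+\infty)$ (at the endpoint $0$: given by a convergent power series in a one-sided neighbourhood). "Non-negative" means $y(x)\ge 0$ for all $x\ge 0$. *)

theory Defs
  imports "HOL-Analysis.Analysis"
begin

definition delta_lhs :: "real \<Rightarrow> real" where
  "delta_lhs x = x / 2 * (1 + x) powr (3/2) * (3 + x) * (1 + (1 + x) powr (3/2))"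

lemma delta_lhs_strict_mono:
  fixes x z :: real
  assumes "0 \<le> x" "x < z"
  shows "delta_lhs x < delta_lhs z"
proof -
  have p: "(1 + x) powr (3/2) < (1 + z) powr (3/2)"
    using assms by (intro powr_less_mono2) auto
  have p0: "0 < (1 + x) powr (3/2)"
    using assms by simp
  have "x / 2 * (1 + x) powr (3/2) < z / 2 * (1 + z) powr (3/2)"
    by (rule mult_strict_mono'[OF _ p]) (use assms p0 in auto)
  then have "x / 2 * (1 + x) powr (3/2) * (3 + x) < z / 2 * (1 + z) powr (3/2) * (3 + z)"
    by (rule mult_strict_mono') (use assms p0 in auto)
  then show ?thesis
    unfolding delta_lhs_def
    by (rule mult_strict_mono'[OF _ add_strict_left_mono[OF p]]) (use assms p0 in auto)
qed

lemma ex1_delta: "\<exists>!x::real. 0 < x \<and> delta_lhs x = 1"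
proof -
  have "1 \<le> (2::real) powr (3/2)"
    by (intro ge_one_powr_ge_zero) auto
  then have up: "1 \<le> delta_lhs 1"
    using mult_mono[of 1 "(2::real) powr (3/2)" 1 "1 + 2 powr (3/2)"]
    by (simp add: delta_lhs_def)
  have low: "delta_lhs 0 \<le> 1"
    by (simp add: delta_lhs_def)
  have "continuous_on {0..1} delta_lhs"
    unfolding delta_lhs_def by (intro continuous_intros) auto
  then obtain x where x: "0 \<le> x" "delta_lhs x = 1"
    using IVT'[of delta_lhs 0 1 1] low up by auto
  then have "x \<noteq> 0"
    by (auto simp: delta_lhs_def)
  moreover have "w = x" if "0 < w" "delta_lhs w = 1" for w
    using delta_lhs_strict_mono[of w x] delta_lhs_strict_mono[of x w] that x
    by (cases w x rule: linorder_cases) auto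
  ultimately show ?thesis
    using x by (intro ex1I[of _ x]) auto
qed

definition delta1 :: real where
  "delta1 = (THE x. 0 < x \<and> delta_lhs x = 1)"

lemma delta1: "0 < delta1" "delta_lhs delta1 = 1"
  using theI'[OF ex1_delta] unfolding delta1_def by auto

text \<open>
  The power series is only required to represent the function on the given set, so at a
  boundary point of an interval the condition is one-sided.
\<close>

definition real_analytic_on :: "(real \<Rightarrow> real) \<Rightarrow> real set \<Rightarrow> bool" where
  "real_analytic_on f S \<longleftrightarrow>
     (\<forall>a\<in>S. \<exists>r>0. \<exists>c::nat \<Rightarrow> real.
        \<forall>x\<in>S. \<bar>x - a\<bar> < r \<longrightarrow> (\<lambda>n. c n * (x - a) ^ n) sums f x)"

text \<open>
  Functions on the half-line are represented by total functions whose values at negative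
  arguments are irrelevant: derivatives are taken at positive points only.  Differentiability
  is stated because \<^const>\<open>deriv\<close> is total.
\<close>

definition solves_bvp :: "real \<Rightarrow> (real \<Rightarrow> real) \<Rightarrow> bool" where
  "solves_bvp \<delta> y \<longleftrightarrow>
     (\<forall>x>0. y differentiable (at x)) \<and>
     (\<forall>x>0. (\<lambda>t. (1 + \<delta> * y t) * deriv y t) differentiable (at x)) \<and>
     (\<forall>x>0. deriv (\<lambda>t. (1 + \<delta> * y t) * deriv y t) x + 2 * x * deriv y x = 0) \<and>
     y 0 = 0 \<and> (y \<longlongrightarrow> 1) at_top"

definition nonneg_analytic_solution :: "real \<Rightarrow> (real \<Rightarrow> real) \<Rightarrow> bool" where
  "nonneg_analytic_solution \<delta> y \<longleftrightarrow>
     solves_bvp \<delta> y \<and> real_analytic_on y {0..} \<and> (\<forall>x\<ge>0. 0 \<le> y x)"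

end

theory Submission
  imports Defs "HOL-Probability.Distributions"
begin

text \<open>
  Write \<open>p = 1 + \<delta> y\<close>. The equation says that the flux \<open>W = p y'\<close> satisfies
  \<open>W' = - (2 x / p) W\<close>. Hence \<open>W\<close> is a constant multiple of
  \<open>E(x) = exp (- \<integral> 2 t / p(t) dt)\<close>, where \<open>t\<close> runs over \<open>[0, x]\<close>, and \<open>y\<close> is a constant multiple
  of the integral of \<open>E / p\<close>. The condition at infinity fixes the constant, so \<open>y\<close> is a fixed point
  of the operator sending \<open>f\<close> to the normalised integral \<open>profile \<delta> f\<close> of
  \<open>slope \<delta> f = decay \<delta> f / (1 + \<delta> f)\<close>.

  For \<open>0 \<le> f \<le> 1\<close> the slope lies between two Gaussians, and perturbing \<open>f\<close> by at most \<open>d\<close> changes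
  it by at most \<open>\<delta> d (1 + x\<^sup>2) exp (- x\<^sup>2 / (1 + \<delta>))\<close>. Integrating these bounds over the half-line
  shows that the operator is a contraction in the supremum norm with constant
  \<open>\<delta> (1 + \<delta>) powr (3/2) (3 + \<delta>)\<close>. This is at most \<open>delta_lhs \<delta>\<close>, which for positive \<open>\<delta>\<close> is
  below 1 exactly when \<open>\<delta> < delta1\<close> (\<open>profile_contraction\<close>). Banach's theorem gives a fixed point, unique among the
  continuous functions with values in \<open>[0, 1]\<close> (\<open>ex1_profile_fixed_point\<close>).

  Every non-negative solution of the boundary value problem is such a fixed point: it is a multiple
  of the integral of a positive function and tends to 1, so it increases and stays below 1
  (\<open>solution_is_fixed_point\<close>). This gives uniqueness. Conversely the fixed point solves the
  boundary value problem.

  What remains is analyticity, also at the end point 0. The functions \<open>1\<close>, \<open>y\<close>, \<open>1 / p\<close>, \<open>x / p\<close>,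
  \<open>y' / p\<close> together satisfy an equation \<open>F' = Q (F, F)\<close> with \<open>Q\<close> bilinear. For such an
  equation the Taylor coefficients of \<open>F\<close> at \<open>x\<close> are given by an explicit recursion in \<open>F x\<close> and grow
  at most geometrically, locally uniformly in \<open>x\<close>, so Taylor's formula converges
  (\<open>real_analytic_on_quadratic_ode\<close>).
\<close>

section \<open>Real analytic functions and quadratic differential equations\<close>

text \<open>
  For the uniqueness proof, analyticity supplies continuity at the end point 0. This connects the
  condition \<open>y 0 = 0\<close> with the values at positive arguments, where the equation holds.
\<close>

lemma real_analytic_on_imp_continuous_on:
  assumes "real_analytic_on f S"
  shows "continuous_on S f"
  unfolding continuous_on_eq_continuous_within
proof
  fix a assume a: "a \<in> S"
  then obtain r c where r: "0 < r"
    and c: "\<And>x. x \<in> S \<Longrightarrow> \<bar>x - a\<bar> < r \<Longrightarrow> (\<lambda>n. c n * (x - a) ^ n) sums f x"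
    using assms unfolding real_analytic_on_def by blast
  show "continuous (at a within S) f"
  proof (cases "\<exists>b\<in>S. b \<noteq> a \<and> \<bar>b - a\<bar> < r")
    case True
    \<comment> \<open>Summability at \<open>b\<close> makes the power series continuous at its centre.\<close>
    then obtain b where b: "b \<in> S" "b \<noteq> a" "\<bar>b - a\<bar> < r" by blast
    then have "isCont (\<lambda>h. \<Sum>n. c n * h ^ n) (a - a)"
      using c[of b] by (intro isCont_powser[of c "b - a"]) (auto simp: sums_iff)
    then have "isCont (\<lambda>x. \<Sum>n. c n * (x - a) ^ n) a"
      by (rule isCont_o2[rotated]) (intro continuous_intros)
    then have "continuous (at a within S) (\<lambda>x. \<Sum>n. c n * (x - a) ^ n)"
      by (rule continuous_at_imp_continuous_within)
    then show ?thesis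
      by (rule continuous_transform_within[OF _ r a]) (use c in \<open>auto simp: dist_real_def sums_iff\<close>)
  next
    case False
    then have "\<not> a islimpt S"
      using r by (auto simp: islimpt_approachable dist_real_def)
    then have "at a within S = bot"
      by (simp add: trivial_limit_within)
    then show ?thesis
      by (simp only: continuous_bot)
  qed
qed

text \<open>
  The \<open>n\<close>-th Taylor coefficient at \<open>x\<close> of a solution of \<open>f' = B f f\<close> with \<open>f x = v\<close>, obtained by
  comparing coefficients of the power series on both sides.
\<close>

fun ode_coeff :: "('a \<Rightarrow> 'a \<Rightarrow> 'a::real_normed_vector) \<Rightarrow> 'a \<Rightarrow> nat \<Rightarrow> 'a" where
  "ode_coeff B v 0 = v"
| "ode_coeff B v (Suc n) =
     (1 / real (Suc n)) *\<^sub>R (\<Sum>m\<le>n. B (ode_coeff B v m) (ode_coeff B v (n - m)))"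

text \<open>
  The bounds \<open>c (K c) ^ n\<close> are the coefficients of \<open>c / (1 - K c h)\<close>, which solves the scalar majorant
  equation \<open>u' = K u\<^sup>2\<close>, \<open>u(0) = c\<close>. In the induction step the factor \<open>1 / (n + 1)\<close> cancels
  the number of terms of the convolution; this is why the equation is taken to be quadratic.
\<close>

lemma norm_ode_coeff_le:
  assumes B: "\<And>x y. norm (B x y) \<le> K * (norm x * norm y)"
    and K: "0 \<le> K" and v: "norm v \<le> c"
  shows "norm (ode_coeff B v n) \<le> c * (K * c) ^ n"
proof (induction n rule: less_induct)
  case (less n)
  have c: "0 \<le> c" using v norm_ge_zero order_trans by blast
  show ?case
  proof (cases n)
    case 0
    then show ?thesis using v by simp
  next
    case (Suc k)
    have "norm (B (ode_coeff B v m) (ode_coeff B v (k - m))) \<le> c * (K * c) ^ Suc k"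
      if "m \<le> k" for m
    proof -
      have "norm (B (ode_coeff B v m) (ode_coeff B v (k - m)))
            \<le> K * ((c * (K * c) ^ m) * (c * (K * c) ^ (k - m)))"
        by (rule order_trans[OF B])
          (use that Suc less K c in \<open>auto intro!: mult_left_mono mult_mono\<close>)
      also have "\<dots> = c * (K * c) * ((K * c) ^ m * (K * c) ^ (k - m))"
        by (simp only: mult_ac)
      also have "(K * c) ^ m * (K * c) ^ (k - m) = (K * c) ^ k"
        using that by (simp flip: power_add)
      finally show ?thesis by simp
    qed
    then have "norm (\<Sum>m\<le>k. B (ode_coeff B v m) (ode_coeff B v (k - m)))
               \<le> real (Suc k) * (c * (K * c) ^ Suc k)"
      by (intro order_trans[OF sum_norm_bound[where K = "c * (K * c) ^ Suc k"]]) auto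
    then show ?thesis
      unfolding Suc ode_coeff.simps by (simp add: field_simps del: of_nat_Suc power_Suc)
  qed
qed

text \<open>
  By induction with the product rule, the coefficients given by the recursion are the derivatives of
  \<open>f\<close> divided by factorials; in particular \<open>f\<close> is smooth. Derivatives are taken within \<open>S\<close>, so that the result applies at an end point of an
  interval.
\<close>

lemma has_vector_derivative_ode_coeff:
  assumes B: "bounded_bilinear B"
    and f: "\<And>x. x \<in> S \<Longrightarrow> (f has_vector_derivative B (f x) (f x)) (at x within S)"
    and x: "x \<in> S"
  shows "((\<lambda>x. ode_coeff B (f x) n) has_vector_derivative
           real (Suc n) *\<^sub>R ode_coeff B (f x) (Suc n)) (at x within S)"
proof (induction n rule: less_induct)
  case (less n)
  interpret bounded_bilinear B by fact
  show ?case
  proof (cases n)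
    case 0
    then show ?thesis using f[OF x] by simp
  next
    case (Suc k)
    let ?a = "ode_coeff B (f x)"
    have "((\<lambda>x. B (ode_coeff B (f x) m) (ode_coeff B (f x) (k - m))) has_vector_derivative
            B (?a m) (real (Suc (k - m)) *\<^sub>R ?a (Suc (k - m)))
            + B (real (Suc m) *\<^sub>R ?a (Suc m)) (?a (k - m))) (at x within S)" if "m \<le> k" for m
      by (intro has_vector_derivative less) (use that Suc in auto)
    then have "((\<lambda>x. \<Sum>m\<le>k. B (ode_coeff B (f x) m) (ode_coeff B (f x) (k - m)))
        has_vector_derivative
          (\<Sum>m\<le>k. B (?a m) (real (Suc (k - m)) *\<^sub>R ?a (Suc (k - m)))
            + B (real (Suc m) *\<^sub>R ?a (Suc m)) (?a (k - m)))) (at x within S)"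
      by (intro has_vector_derivative_sum) auto
    \<comment> \<open>The two halves of the product rule become the same convolution of order \<open>k + 1\<close>, with weights
      \<open>k + 1 - m\<close> and \<open>m\<close>; their sum \<open>k + 1\<close> cancels the factor in the recursion.\<close>
    also have "(\<Sum>m\<le>k. B (?a m) (real (Suc (k - m)) *\<^sub>R ?a (Suc (k - m)))
            + B (real (Suc m) *\<^sub>R ?a (Suc m)) (?a (k - m)))
        = (\<Sum>m\<le>k. real (Suc k - m) *\<^sub>R B (?a m) (?a (Suc k - m)))
          + (\<Sum>m\<le>k. real (Suc m) *\<^sub>R B (?a (Suc m)) (?a (Suc k - Suc m)))"
      by (simp add: sum.distrib scaleR_left scaleR_right Suc_diff_le)
    also have "(\<Sum>m\<le>k. real (Suc k - m) *\<^sub>R B (?a m) (?a (Suc k - m)))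
        = (\<Sum>m\<le>Suc k. real (Suc k - m) *\<^sub>R B (?a m) (?a (Suc k - m)))"
      by simp
    also have "(\<Sum>m\<le>k. real (Suc m) *\<^sub>R B (?a (Suc m)) (?a (Suc k - Suc m)))
        = (\<Sum>m\<le>Suc k. real m *\<^sub>R B (?a m) (?a (Suc k - m)))"
      by (subst sum.atMost_Suc_shift) simp
    also have "(\<Sum>m\<le>Suc k. real (Suc k - m) *\<^sub>R B (?a m) (?a (Suc k - m)))
        + (\<Sum>m\<le>Suc k. real m *\<^sub>R B (?a m) (?a (Suc k - m)))
        = real (Suc k) *\<^sub>R (\<Sum>m\<le>Suc k. B (?a m) (?a (Suc k - m)))"
      unfolding sum.distrib[symmetric] scaleR_sum_right
      by (intro sum.cong refl) (simp add: scaleR_left_distrib[symmetric] of_nat_diff)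
    finally have "((\<lambda>x. (1 / real (Suc k)) *\<^sub>R
          (\<Sum>m\<le>k. B (ode_coeff B (f x) m) (ode_coeff B (f x) (k - m))))
        has_vector_derivative (1 / real (Suc k)) *\<^sub>R
          (real (Suc k) *\<^sub>R (\<Sum>m\<le>Suc k. B (?a m) (?a (Suc k - m))))) (at x within S)"
      by (intro bounded_linear.has_vector_derivative[OF bounded_linear_scaleR_right])
    then show ?thesis
      unfolding Suc by (simp del: of_nat_Suc sum.atMost_Suc)
  qed
qed

text \<open>
  Near \<open>a\<close> the solution is bounded by some \<open>c\<close>, so the coefficients at all nearby points have a common
  geometric bound, and the remainder in Taylor's formula tends to 0. The
  linear form \<open>l\<close> picks a component of a system.
\<close>

theorem real_analytic_on_quadratic_ode:
  fixes f :: "real \<Rightarrow> 'a::real_normed_vector" and l :: "'a \<Rightarrow> real"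
  assumes B: "bounded_bilinear B" and l: "bounded_linear l" and S: "convex S"
    and f: "\<And>x. x \<in> S \<Longrightarrow> (f has_vector_derivative B (f x) (f x)) (at x within S)"
  shows "real_analytic_on (\<lambda>x. l (f x)) S"
  unfolding real_analytic_on_def
proof
  fix a assume a: "a \<in> S"
  obtain K where K: "0 < K" "\<And>x y. norm (B x y) \<le> norm x * norm y * K"
    using bounded_bilinear.pos_bounded[OF B] by auto
  obtain L where L: "0 < L" "\<And>x. norm (l x) \<le> norm x * L"
    using bounded_linear.pos_bounded[OF l] by auto
  define c where "c = norm (f a) + 1"
  have c: "0 < c" unfolding c_def by (simp add: add_nonneg_pos)
  have "continuous (at a within S) f"
    using f[OF a] has_vector_derivative_continuous by blast
  then obtain r0 where r0: "0 < r0" "\<And>x. x \<in> S \<Longrightarrow> dist x a < r0 \<Longrightarrow> dist (f x) (f a) < 1"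
    unfolding continuous_within_eps_delta by (metis zero_less_one)
  define \<rho> where "\<rho> = K * c"
  have \<rho>: "0 < \<rho>" using K c by (simp add: \<rho>_def)
  \<comment> \<open>Half the radius \<open>1 / \<rho>\<close> of convergence of the majorant, so that the error decays like
    \<open>n / 2 ^ n\<close>.\<close>
  define r where "r = min r0 (1 / (2 * \<rho>))"
  have r: "0 < r" "r \<le> r0" "r * \<rho> \<le> 1 / 2"
    using r0 \<rho> by (auto simp: r_def min_def field_simps)
  define T where "T = S \<inter> ball a r"
  have T: "convex T" "a \<in> T" unfolding T_def using S a r by (auto intro: convex_Int)
  have f_le: "norm (f x) \<le> c" if "x \<in> T" for x
  proof -
    have "dist (f x) (f a) < 1"
      using that r by (intro r0) (auto simp: T_def dist_commute)
    then show ?thesis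
      using norm_triangle_sub[of "f x" "f a"] by (simp add: c_def dist_norm)
  qed
  define g where "g n x = fact n * l (ode_coeff B (f x) n)" for n x
  have g_deriv: "(g n has_field_derivative g (Suc n) x) (at x within T)" if "x \<in> T" for n x
  proof -
    have "((\<lambda>x. l (ode_coeff B (f x) n)) has_vector_derivative
            l (real (Suc n) *\<^sub>R ode_coeff B (f x) (Suc n))) (at x within T)"
      using that
      by (intro bounded_linear.has_vector_derivative[OF l]
          has_vector_derivative_within_subset[OF has_vector_derivative_ode_coeff[OF B f]])
        (auto simp: T_def)
    then have "((\<lambda>x. l (ode_coeff B (f x) n)) has_field_derivative
            real (Suc n) * l (ode_coeff B (f x) (Suc n))) (at x within T)"
      by (simp only: has_real_derivative_iff_has_vector_derivative
          linear_cmul[OF bounded_linear.linear[OF l]] real_scaleR_def)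
    from DERIV_cmult[OF this, of "fact n"] show ?thesis
      unfolding g_def by (simp add: algebra_simps)
  qed
  have g_le: "norm (g n x) \<le> fact n * (c * \<rho> ^ n * L)" if "x \<in> T" for n x
  proof -
    have "norm (ode_coeff B (f x) n) \<le> c * (K * c) ^ n"
      using K f_le[OF that] by (intro norm_ode_coeff_le) (auto simp: mult_ac)
    then have "norm (l (ode_coeff B (f x) n)) \<le> c * (K * c) ^ n * L"
      by (intro order_trans[OF L(2)] mult_right_mono) (use L in auto)
    then show ?thesis
      unfolding g_def \<rho>_def norm_mult by (intro mult_mono) auto
  qed
  have "(\<lambda>n. l (ode_coeff B (f a) n) * (x - a) ^ n) sums l (f x)"
    if x: "x \<in> S" "\<bar>x - a\<bar> < r" for x
  proof -
    have xT: "x \<in> T" using x by (auto simp: T_def dist_real_def)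
    have err: "norm (l (f x) - (\<Sum>i\<le>n. l (ode_coeff B (f a) i) * (x - a) ^ i))
               \<le> c * L * (real (Suc n) * (1 / 2) ^ Suc n)" for n
    proof -
      have "norm (g 0 x - (\<Sum>i\<le>n. g i a * (x - a) ^ i / fact i))
            \<le> (fact (Suc n) * (c * \<rho> ^ Suc n * L)) * norm (x - a) ^ Suc n / fact n"
        by (rule field_Taylor[OF T(1)])
          (use g_deriv g_le[of _ "Suc n"] T xT in \<open>auto simp del: fact_Suc power_Suc\<close>)
      also have "\<dots> = c * L * (real (Suc n) * (\<rho> * \<bar>x - a\<bar>) ^ Suc n)"
        by (simp add: power_mult_distrib field_simps del: power_Suc)
      also have "\<dots> \<le> c * L * (real (Suc n) * (1 / 2) ^ Suc n)"
      proof (intro mult_left_mono power_mono)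
        show "\<rho> * \<bar>x - a\<bar> \<le> 1 / 2"
          using order_trans[OF mult_left_mono[of "\<bar>x - a\<bar>" r \<rho>], of "1 / 2"] x r(3) \<rho>
          by (simp add: mult.commute)
      qed (use c L \<rho> in auto)
      finally show ?thesis by (simp add: g_def)
    qed
    have "(\<lambda>n. real (Suc n) * (1 / 2) ^ Suc n :: real) \<longlonglongrightarrow> 0"
      using LIMSEQ_Suc[OF powser_times_n_limit_0[of "1/2 :: real"]] by simp
    then have "(\<lambda>n. c * L * (real (Suc n) * (1 / 2) ^ Suc n)) \<longlonglongrightarrow> 0"
      by (rule tendsto_mult_right_zero)
    then have "(\<lambda>n. l (f x) - (\<Sum>i\<le>n. l (ode_coeff B (f a) i) * (x - a) ^ i)) \<longlonglongrightarrow> 0"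
      by (rule Lim_null_comparison[rotated]) (use err in auto)
    then have "(\<lambda>n. \<Sum>i\<le>n. l (ode_coeff B (f a) i) * (x - a) ^ i) \<longlonglongrightarrow> l (f x)"
      using tendsto_diff[OF tendsto_const[of "l (f x)"]] by fastforce
    then show ?thesis by (simp add: sums_def_le)
  qed
  then show "\<exists>r>0. \<exists>c. \<forall>x\<in>S. \<bar>x - a\<bar> < r \<longrightarrow> (\<lambda>n. c n * (x - a) ^ n) sums l (f x)"
    using r(1) by (intro exI[of _ r] conjI exI[of _ "\<lambda>n. l (ode_coeff B (f a) n)"]) auto
qed

section \<open>Integrals over the half-line\<close>

lemma has_integral_gaussian_moments:
  fixes k :: real
  assumes k: "0 < k"
  shows "((\<lambda>s. exp (- s\<^sup>2 / k)) has_integral sqrt pi / 2 * sqrt k) {0..}" (is ?zeroth)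
    and "((\<lambda>s. s\<^sup>2 * exp (- s\<^sup>2 / k)) has_integral sqrt pi / 4 * (k * sqrt k)) {0..}" (is ?second)
proof -
  \<comment> \<open>The substitution \<open>s = sqrt k * u\<close> reduces to \<open>k = 1\<close>.\<close>
  have *: "((\<lambda>s. (s / sqrt k) ^ (2 * n) * exp (- s\<^sup>2 / k)) has_integral
      (sqrt pi / 2 * (fact (2 * n) / (2 ^ (2 * n) * fact n))) * sqrt k) {0..}" for n
  proof -
    let ?I = "sqrt pi / 2 * (fact (2 * n) / (2 ^ (2 * n) * fact n)) :: real"
    have "has_bochner_integral lborel
        (\<lambda>s. indicator {0..} (0 + 1 / sqrt k * s) *\<^sub>R
          (exp (- (0 + 1 / sqrt k * s)\<^sup>2) * (0 + 1 / sqrt k * s) ^ (2 * n))) (?I /\<^sub>R \<bar>1 / sqrt k\<bar>)"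
      by (subst lborel_has_bochner_integral_real_affine_iff[symmetric])
        (use k gaussian_moment_even_pos[of n] in auto)
    also have "(\<lambda>s. indicator {0..} (0 + 1 / sqrt k * s) *\<^sub>R
          (exp (- (0 + 1 / sqrt k * s)\<^sup>2) * (0 + 1 / sqrt k * s) ^ (2 * n)))
        = (\<lambda>s. if s \<in> {0..} then (s / sqrt k) ^ (2 * n) * exp (- s\<^sup>2 / k) else 0)"
      using k by (auto simp: fun_eq_iff power_divide zero_le_divide_iff)
    finally show ?thesis
      using k
      by (subst has_integral_restrict_UNIV[symmetric])
        (auto simp: has_bochner_integral_iff mult.commute dest!: has_integral_integral_lborel)
  qed
  show ?zeroth using *[of 0] by simp
  have "((\<lambda>s. k * ((s / sqrt k) ^ (2 * 1) * exp (- s\<^sup>2 / k))) has_integral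
      k * ((sqrt pi / 2 * (fact (2 * 1) / (2 ^ (2 * 1) * fact 1))) * sqrt k)) {0..}"
    by (intro has_integral_mult_right *)
  then show ?second using k by (simp add: power_divide fact_2 mult_ac)
qed

lemma has_integral_linear_from_0:
  fixes c x :: real
  assumes "0 \<le> x"
  shows "((\<lambda>t. c * (2 * t)) has_integral c * x\<^sup>2) {0..x}"
proof -
  have "((\<lambda>t. c * (2 * t)) has_integral c * x\<^sup>2 - c * 0\<^sup>2) {0..x}"
    using assms
    by (intro fundamental_theorem_of_calculus)
      (auto intro!: derivative_eq_intros simp flip: has_real_derivative_iff_has_vector_derivative)
  then show ?thesis by simp
qed

lemma has_real_derivative_integral_halfline:
  fixes h :: "real \<Rightarrow> real"
  assumes "continuous_on {0..} h" "0 \<le> x"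
  shows "((\<lambda>x. integral {0..x} h) has_real_derivative h x) (at x within {0..})"
proof -
  have "((\<lambda>x. integral {0..x} h) has_real_derivative h x) (at x within {0..x + 1})"
    using assms by (intro integral_has_real_derivative continuous_on_subset[OF assms(1)]) auto
  moreover have "at x within {0..} = at x within {0..x + 1}"
    by (rule at_within_nhd[of _ "{..<x + 1}"]) auto
  ultimately show ?thesis by simp
qed

lemma integral_interval_tendsto_halfline:
  fixes h :: "real \<Rightarrow> real"
  assumes "h integrable_on {0..}" "\<And>x. 0 \<le> x \<Longrightarrow> 0 \<le> h x"
  shows "((\<lambda>x. integral {0..x} h) \<longlongrightarrow> integral {0..} h) at_top"
proof -
  have abs: "h absolutely_integrable_on {0..}"
    using assms by (intro nonnegative_absolutely_integrable_1) auto
  have "((\<lambda>b. LINT x:{0..b}|lebesgue. h x) \<longlongrightarrow> (LINT x:{0..}|lebesgue. h x)) at_top"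
    by (rule tendsto_set_lebesgue_integral_at_top) (use abs in auto)
  moreover have "(LINT x:{0..b}|lebesgue. h x) = integral {0..b} h" for b
    by (intro set_lebesgue_integral_eq_integral set_integrable_subset[OF abs]) auto
  moreover have "(LINT x:{0..}|lebesgue. h x) = integral {0..} h"
    by (intro set_lebesgue_integral_eq_integral abs)
  ultimately show ?thesis by simp
qed

section \<open>The integral operator\<close>

text \<open>
  Up to a constant factor, \<open>decay \<delta> f\<close> is the flux \<open>(1 + \<delta> f) y'\<close> and \<open>slope \<delta> f\<close> the derivative \<open>y'\<close>
  of a solution of the linear equation with given coefficient \<open>1 + \<delta> f\<close>; that is, of
  \<open>W' + (2 x / (1 + \<delta> f)) W = 0\<close> for the flux \<open>W\<close>. Then \<open>profile \<delta> f\<close> is the solution with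
  boundary values 0 and 1.
\<close>

definition decay :: "real \<Rightarrow> (real \<Rightarrow> real) \<Rightarrow> real \<Rightarrow> real" where
  "decay \<delta> f x = exp (- integral {0..x} (\<lambda>t. 2 * t / (1 + \<delta> * f t)))"

definition slope :: "real \<Rightarrow> (real \<Rightarrow> real) \<Rightarrow> real \<Rightarrow> real" where
  "slope \<delta> f x = decay \<delta> f x / (1 + \<delta> * f x)"

definition profile :: "real \<Rightarrow> (real \<Rightarrow> real) \<Rightarrow> real \<Rightarrow> real" where
  "profile \<delta> f x = integral {0..x} (slope \<delta> f) / integral {0..} (slope \<delta> f)"

text \<open>
  The upper bound 1 is kept in a second locale: a given solution must first be represented with the
  lower bound alone, and only this representation shows that it is at most 1.
\<close>

locale conductivity =
  fixes \<delta> :: real and f :: "real \<Rightarrow> real"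
  assumes \<delta>: "0 < \<delta>"
    and cont: "continuous_on {0..} f"
    and nonneg: "0 \<le> x \<Longrightarrow> 0 \<le> f x"
begin

lemma conductivity_ge_1: "0 \<le> x \<Longrightarrow> 1 \<le> 1 + \<delta> * f x"
  using nonneg[of x] \<delta> by simp

lemma conductivity_pos: "0 \<le> x \<Longrightarrow> 0 < 1 + \<delta> * f x"
  using conductivity_ge_1[of x] by linarith

lemma continuous_on_rate: "continuous_on {0..} (\<lambda>t. 2 * t / (1 + \<delta> * f t))"
  using conductivity_pos by (intro continuous_intros cont) force

lemma rate_integrable: "(\<lambda>t. 2 * t / (1 + \<delta> * f t)) integrable_on {0..x}"
  by (intro integrable_continuous_real continuous_on_subset[OF continuous_on_rate]) auto

lemma decay_deriv:
  assumes "0 \<le> x"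
  shows "(decay \<delta> f has_real_derivative - (2 * x / (1 + \<delta> * f x)) * decay \<delta> f x)
           (at x within {0..})"
  unfolding decay_def
  by (rule derivative_eq_intros refl
      has_real_derivative_integral_halfline[OF continuous_on_rate assms])+ simp

lemma continuous_on_slope: "continuous_on {0..} (slope \<delta> f)"
proof -
  have "continuous_on {0..} (decay \<delta> f)"
    by (intro DERIV_continuous_on[OF decay_deriv]) auto
  then show ?thesis
    unfolding slope_def using conductivity_pos by (intro continuous_intros cont) force+
qed

lemma decay_pos: "0 < decay \<delta> f x"
  by (simp add: decay_def)

lemma slope_pos: "0 \<le> x \<Longrightarrow> 0 < slope \<delta> f x"
  using conductivity_pos decay_pos by (simp add: slope_def)

lemma slope_integrable: "0 \<le> a \<Longrightarrow> slope \<delta> f integrable_on {a..b}"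
  by (intro integrable_continuous_real continuous_on_subset[OF continuous_on_slope]) auto

lemma integral_slope_mono:
  assumes "a \<le> b"
  shows "integral {0..a} (slope \<delta> f) \<le> integral {0..b} (slope \<delta> f)"
  using assms slope_pos
  by (intro integral_subset_le slope_integrable) (auto intro: less_imp_le)

end

locale bounded_conductivity = conductivity +
  assumes le_1: "0 \<le> x \<Longrightarrow> f x \<le> 1"
begin

lemma conductivity_le: "0 \<le> x \<Longrightarrow> 1 + \<delta> * f x \<le> 1 + \<delta>"
  using le_1[of x] \<delta> by simp

lemma rate_integral_ge:
  assumes "0 \<le> x"
  shows "x\<^sup>2 / (1 + \<delta>) \<le> integral {0..x} (\<lambda>t. 2 * t / (1 + \<delta> * f t))"
proof (rule has_integral_le[OF _ integrable_integral[OF rate_integrable]])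
  show "((\<lambda>t. 2 * t / (1 + \<delta>)) has_integral x\<^sup>2 / (1 + \<delta>)) {0..x}"
    using has_integral_linear_from_0[OF assms, of "1 / (1 + \<delta>)"] by simp
  show "2 * t / (1 + \<delta>) \<le> 2 * t / (1 + \<delta> * f t)" if "t \<in> {0..x}" for t
    using that conductivity_le[of t] conductivity_pos[of t] by (auto intro!: divide_left_mono)
qed

lemma rate_integral_le:
  assumes "0 \<le> x"
  shows "integral {0..x} (\<lambda>t. 2 * t / (1 + \<delta> * f t)) \<le> x\<^sup>2"
proof (rule has_integral_le[OF integrable_integral[OF rate_integrable]])
  show "((\<lambda>t. 2 * t) has_integral x\<^sup>2) {0..x}"
    using has_integral_linear_from_0[OF assms, of 1] by simp
  show "2 * t / (1 + \<delta> * f t) \<le> 2 * t" if "t \<in> {0..x}" for t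
    using that frac_le[of "2 * t" "2 * t" 1 "1 + \<delta> * f t"] conductivity_ge_1[of t] by simp
qed

lemma slope_le:
  assumes "0 \<le> x"
  shows "slope \<delta> f x \<le> exp (- x\<^sup>2 / (1 + \<delta>))"
proof -
  have "slope \<delta> f x \<le> decay \<delta> f x / 1"
    unfolding slope_def
    using conductivity_ge_1[OF assms] decay_pos[of x] by (intro divide_left_mono) auto
  also have "\<dots> \<le> exp (- x\<^sup>2 / (1 + \<delta>))"
    using rate_integral_ge[OF assms] by (simp add: decay_def)
  finally show ?thesis .
qed

lemma slope_ge:
  assumes "0 \<le> x"
  shows "exp (- x\<^sup>2) / (1 + \<delta>) \<le> slope \<delta> f x"
  unfolding slope_def decay_def
  using rate_integral_le[OF assms] conductivity_le[OF assms] conductivity_pos[OF assms]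
  by (intro frac_le) auto

text \<open>
  The bound \<open>f \<le> 1\<close> is what makes the total integral finite and comparable to Gaussian integrals.
\<close>

lemma slope_integrable_halfline: "slope \<delta> f integrable_on {0..}"
proof (rule measurable_bounded_by_integrable_imp_integrable_real)
  show "slope \<delta> f \<in> borel_measurable (lebesgue_on {0..})"
    by (intro continuous_imp_measurable_on_sets_lebesgue continuous_on_slope) auto
  show "(\<lambda>s. exp (- s\<^sup>2 / (1 + \<delta>))) integrable_on {0..}"
    using has_integral_gaussian_moments(1)[of "1 + \<delta>"] \<delta> by auto
  show "\<bar>slope \<delta> f x\<bar> \<le> exp (- x\<^sup>2 / (1 + \<delta>))" if "x \<in> {0..}" for x
    using that slope_le[of x] slope_pos[of x] by auto
qed auto

lemma integral_slope_ge: "sqrt pi / 2 / (1 + \<delta>) \<le> integral {0..} (slope \<delta> f)"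
proof (rule has_integral_le[OF _ integrable_integral[OF slope_integrable_halfline]])
  show "((\<lambda>s. exp (- s\<^sup>2) / (1 + \<delta>)) has_integral sqrt pi / 2 / (1 + \<delta>)) {0..}"
    using has_integral_divide[OF has_integral_gaussian_moments(1)[of 1], of "1 + \<delta>"] by simp
qed (use slope_ge in auto)

lemma integral_slope_pos: "0 < integral {0..} (slope \<delta> f)"
  by (rule less_le_trans[OF _ integral_slope_ge]) (use \<delta> in auto)

lemma integral_slope_le: "integral {0..x} (slope \<delta> f) \<le> integral {0..} (slope \<delta> f)"
  using slope_pos slope_integrable_halfline
  by (intro integral_subset_le slope_integrable) (auto intro: less_imp_le)

lemma profile_bounds: "0 \<le> profile \<delta> f x" "profile \<delta> f x \<le> 1"
  unfolding profile_def using integral_slope_pos integral_slope_le[of x] slope_pos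
  by (auto intro!: divide_nonneg_pos Henstock_Kurzweil_Integration.integral_nonneg slope_integrable intro: less_imp_le)

lemma profile_deriv:
  "0 \<le> x \<Longrightarrow> (profile \<delta> f has_real_derivative slope \<delta> f x / integral {0..} (slope \<delta> f))
    (at x within {0..})"
  unfolding profile_def
  by (intro DERIV_cdivide has_real_derivative_integral_halfline continuous_on_slope)

lemma profile_tendsto: "(profile \<delta> f \<longlongrightarrow> 1) at_top"
proof -
  have "((\<lambda>x. integral {0..x} (slope \<delta> f)) \<longlongrightarrow> integral {0..} (slope \<delta> f)) at_top"
    using slope_pos
    by (intro integral_interval_tendsto_halfline slope_integrable_halfline) (auto intro: less_imp_le)
  from tendsto_divide[OF this tendsto_const[of "integral {0..} (slope \<delta> f)"]]
  show ?thesis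
    using integral_slope_pos by (simp add: profile_def[abs_def])
qed

end

section \<open>Contraction\<close>

text \<open>
  The mean value theorem bounds the difference by \<open>\<bar>a - b\<bar>\<close> times the larger exponential. The common lower
  bound \<open>m\<close> of the exponents keeps the Gaussian factor in the estimate of \<open>decay\<close>.
\<close>

lemma abs_exp_diff_le:
  fixes a b m :: real
  assumes "m \<le> a" "m \<le> b"
  shows "\<bar>exp (- a) - exp (- b)\<bar> \<le> \<bar>a - b\<bar> * exp (- m)"
proof -
  have *: "exp (- a) - exp (- b) \<le> (b - a) * exp (- m)" if "m \<le> a" "a \<le> b" for a b :: real
  proof -
    have "exp (- a) - exp (- b) = exp (- a) * (1 - exp (- (b - a)))"
      by (simp add: algebra_simps flip: exp_add)
    also have "\<dots> \<le> exp (- a) * (b - a)"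
      using exp_ge_add_one_self[of "- (b - a)"] by (intro mult_left_mono[OF _ exp_ge_zero]) linarith
    also have "\<dots> \<le> exp (- m) * (b - a)"
      using that by (intro mult_right_mono) auto
    finally show ?thesis by (simp add: mult.commute)
  qed
  show ?thesis
    using *[of a b] *[of b a] assms by (cases "a \<le> b") (auto simp: abs_if)
qed

text \<open>
  Since \<open>slope = decay / (1 + \<delta> f)\<close>, the difference splits into two parts. Each factor
  \<open>1 / (1 + \<delta> f)\<close> changes by at most \<open>\<delta> d\<close>, because \<open>1 + \<delta> f \<ge> 1\<close>. The exponent in \<open>decay\<close> is the
  integral of \<open>2 t\<close> times such a factor, so it changes by at most \<open>\<delta> d x\<^sup>2\<close>.
\<close>

lemma slope_diff_le:
  assumes f: "bounded_conductivity \<delta> f" and g: "bounded_conductivity \<delta> g"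
    and d: "\<And>t. 0 \<le> t \<Longrightarrow> \<bar>f t - g t\<bar> \<le> d" and x: "0 \<le> x"
  shows "\<bar>slope \<delta> f x - slope \<delta> g x\<bar> \<le> \<delta> * d * ((1 + x\<^sup>2) * exp (- x\<^sup>2 / (1 + \<delta>)))"
proof -
  interpret f: bounded_conductivity \<delta> f by fact
  interpret g: bounded_conductivity \<delta> g by fact
  let ?G = "exp (- x\<^sup>2 / (1 + \<delta>))"
  have inverse: "\<bar>1 / (1 + \<delta> * f t) - 1 / (1 + \<delta> * g t)\<bar> \<le> \<delta> * d" if "0 \<le> t" for t
  proof -
    have "1 * 1 \<le> (1 + \<delta> * f t) * (1 + \<delta> * g t)"
      using that f.conductivity_ge_1 g.conductivity_ge_1 by (intro mult_mono) force+
    moreover have "1 / (1 + \<delta> * f t) - 1 / (1 + \<delta> * g t)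
        = \<delta> * (g t - f t) / ((1 + \<delta> * f t) * (1 + \<delta> * g t))"
      using f.conductivity_pos[OF that] g.conductivity_pos[OF that] by (simp add: field_simps)
    ultimately have "\<bar>1 / (1 + \<delta> * f t) - 1 / (1 + \<delta> * g t)\<bar> \<le> \<delta> * \<bar>g t - f t\<bar> / 1"
      using f.\<delta> by (simp only: abs_divide abs_mult[of \<delta>]) (intro frac_le, auto)
    also have "\<dots> \<le> \<delta> * d"
      using d[OF that] f.\<delta> by (simp add: abs_minus_commute)
    finally show ?thesis .
  qed
  have "\<bar>integral {0..x} (\<lambda>t. 2 * t / (1 + \<delta> * f t)) - integral {0..x} (\<lambda>t. 2 * t / (1 + \<delta> * g t))\<bar>
      = \<bar>integral {0..x} (\<lambda>t. 2 * t / (1 + \<delta> * f t) - 2 * t / (1 + \<delta> * g t))\<bar>"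
    by (simp add: Henstock_Kurzweil_Integration.integral_diff f.rate_integrable g.rate_integrable)
  also have "\<dots> \<le> integral {0..x} (\<lambda>t. \<delta> * d * (2 * t))"
  proof (rule Henstock_Kurzweil_Integration.integral_norm_bound_integral[where 'a = real, simplified real_norm_def])
    fix t assume t: "t \<in> {0..x}"
    have "2 * t / (1 + \<delta> * f t) - 2 * t / (1 + \<delta> * g t)
        = 2 * t * (1 / (1 + \<delta> * f t) - 1 / (1 + \<delta> * g t))"
      by (simp add: right_diff_distrib)
    also have "\<bar>\<dots>\<bar> = 2 * t * \<bar>1 / (1 + \<delta> * f t) - 1 / (1 + \<delta> * g t)\<bar>"
      using t by (subst abs_mult) simp
    also have "\<dots> \<le> 2 * t * (\<delta> * d)"
      using t inverse by (intro mult_left_mono) auto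
    finally show "\<bar>2 * t / (1 + \<delta> * f t) - 2 * t / (1 + \<delta> * g t)\<bar> \<le> \<delta> * d * (2 * t)"
      by (simp add: mult_ac)
  qed (use has_integral_linear_from_0[OF x] f.rate_integrable g.rate_integrable
      in \<open>auto intro: Henstock_Kurzweil_Integration.integrable_diff\<close>)
  also have "\<dots> = \<delta> * d * x\<^sup>2"
    using has_integral_linear_from_0[OF x] by (rule integral_unique)
  finally have rate: "\<bar>integral {0..x} (\<lambda>t. 2 * t / (1 + \<delta> * f t))
      - integral {0..x} (\<lambda>t. 2 * t / (1 + \<delta> * g t))\<bar> \<le> \<delta> * d * x\<^sup>2" .
  have "\<bar>decay \<delta> f x - decay \<delta> g x\<bar> \<le> \<delta> * d * x\<^sup>2 * ?G"
    unfolding decay_def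
    using order_trans[OF abs_exp_diff_le[OF f.rate_integral_ge[OF x] g.rate_integral_ge[OF x]]
        mult_right_mono[OF rate]] by simp
  then have 1: "\<bar>(decay \<delta> f x - decay \<delta> g x) / (1 + \<delta> * f x)\<bar> \<le> \<delta> * d * x\<^sup>2 * ?G / 1"
    unfolding abs_divide using f.conductivity_ge_1[OF x] by (intro frac_le) auto
  have "decay \<delta> g x \<le> ?G"
    using g.rate_integral_ge[OF x] by (simp add: decay_def)
  then have 2: "\<bar>decay \<delta> g x * (1 / (1 + \<delta> * f x) - 1 / (1 + \<delta> * g x))\<bar> \<le> ?G * (\<delta> * d)"
    unfolding abs_mult using inverse[OF x] g.decay_pos[of x] by (intro mult_mono) auto
  have "slope \<delta> f x - slope \<delta> g x = (decay \<delta> f x - decay \<delta> g x) / (1 + \<delta> * f x)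
      + decay \<delta> g x * (1 / (1 + \<delta> * f x) - 1 / (1 + \<delta> * g x))"
    by (simp add: slope_def algebra_simps diff_divide_distrib)
  then have "\<bar>slope \<delta> f x - slope \<delta> g x\<bar> \<le> \<delta> * d * x\<^sup>2 * ?G + ?G * (\<delta> * d)"
    using 1 2 by linarith
  then show ?thesis by (simp add: algebra_simps)
qed

text \<open>
  With \<open>k = 1 + \<delta>\<close>, both the partial and the total integral of the slope change by at most
  \<open>I = \<delta> d (sqrt \<pi> / 4) sqrt k (2 + k)\<close>, and the total integral is at least \<open>sqrt \<pi> / (2 k)\<close>. As the
  quotient \<open>profile\<close> is at most 1, it changes by at most
  \<open>2 I / (sqrt \<pi> / (2 k)) = \<delta> d k sqrt k (2 + k)\<close>. Finally \<open>delta_lhs \<delta>\<close> is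
  \<open>\<delta> k sqrt k (2 + k)\<close> times the mean of 1 and \<open>k sqrt k \<ge> 1\<close>.
\<close>

lemma profile_contraction:
  assumes f: "bounded_conductivity \<delta> f" and g: "bounded_conductivity \<delta> g"
    and d: "\<And>t. 0 \<le> t \<Longrightarrow> \<bar>f t - g t\<bar> \<le> d" and x: "0 \<le> x"
  shows "\<bar>profile \<delta> f x - profile \<delta> g x\<bar> \<le> delta_lhs \<delta> * d"
proof -
  interpret f: bounded_conductivity \<delta> f by fact
  interpret g: bounded_conductivity \<delta> g by fact
  define k where "k = 1 + \<delta>"
  have k: "1 < k" using f.\<delta> by (simp add: k_def)
  have d0: "0 \<le> d" using d[of 0] by linarith
  let ?G = "\<lambda>s. \<delta> * d * ((1 + s\<^sup>2) * exp (- s\<^sup>2 / k))"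
  define I where "I = \<delta> * d * (sqrt pi / 2 * sqrt k + sqrt pi / 4 * (k * sqrt k))"
  have G: "(?G has_integral I) {0..}"
  proof -
    have "((\<lambda>s. \<delta> * d * (exp (- s\<^sup>2 / k) + s\<^sup>2 * exp (- s\<^sup>2 / k))) has_integral
        \<delta> * d * (sqrt pi / 2 * sqrt k + sqrt pi / 4 * (k * sqrt k))) {0..}"
      using k by (intro has_integral_mult_right has_integral_add has_integral_gaussian_moments) auto
    then show ?thesis by (simp add: I_def algebra_simps)
  qed
  let ?A = "\<lambda>f x. integral {0..x} (slope \<delta> f)" and ?B = "\<lambda>f. integral {0..} (slope \<delta> f)"
  have diff: "\<bar>integral S (slope \<delta> f) - integral S (slope \<delta> g)\<bar> \<le> I"
    if "slope \<delta> f integrable_on S" "slope \<delta> g integrable_on S" "?G integrable_on S" "S \<subseteq> {0..}" for S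
  proof -
    have "\<bar>integral S (slope \<delta> f) - integral S (slope \<delta> g)\<bar>
        = \<bar>integral S (\<lambda>s. slope \<delta> f s - slope \<delta> g s)\<bar>"
      using that by (simp add: Henstock_Kurzweil_Integration.integral_diff)
    also have "\<dots> \<le> integral S ?G"
      using that slope_diff_le[OF f g d, folded k_def]
      by (intro Henstock_Kurzweil_Integration.integral_norm_bound_integral
          [where 'a = real, simplified real_norm_def]
          Henstock_Kurzweil_Integration.integrable_diff) auto
    also have "\<dots> \<le> integral {0..} ?G"
      using that G f.\<delta> d0 by (intro integral_subset_le) auto
    also have "\<dots> = I"
      using G by (rule integral_unique)
    finally show ?thesis .
  qed
  have A: "\<bar>?A f x - ?A g x\<bar> \<le> I"
    by (intro diff f.slope_integrable g.slope_integrable integrable_continuous_real continuous_intros)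
      (use k in auto)
  have B: "\<bar>?B f - ?B g\<bar> \<le> I"
    using G by (intro diff f.slope_integrable_halfline g.slope_integrable_halfline) auto
  \<comment> \<open>\<open>a / b - a' / b' = ((a - a') - (a' / b') (b - b')) / b\<close>, where \<open>0 \<le> a' / b' \<le> 1\<close>.\<close>
  have "profile \<delta> f x - profile \<delta> g x
      = ((?A f x - ?A g x) - profile \<delta> g x * (?B f - ?B g)) / ?B f"
    using f.integral_slope_pos g.integral_slope_pos by (simp add: profile_def field_simps)
  also have "\<bar>\<dots>\<bar> \<le> (I + 1 * I) / (sqrt pi / 2 / k)"
    unfolding abs_divide
  proof (intro frac_le)
    have "\<bar>profile \<delta> g x * (?B f - ?B g)\<bar> \<le> 1 * I"
      unfolding abs_mult using g.profile_bounds[of x] B by (intro mult_mono) auto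
    then show "\<bar>?A f x - ?A g x - profile \<delta> g x * (?B f - ?B g)\<bar> \<le> I + 1 * I"
      using A by linarith
    show "sqrt pi / 2 / k \<le> \<bar>?B f\<bar>"
      using f.integral_slope_ge by (simp add: k_def)
  qed (use A k in auto)
  also have "\<dots> = \<delta> * (k * sqrt k) * (2 + k) * d"
    using k by (simp add: I_def field_simps)
  also have "\<dots> \<le> delta_lhs \<delta> * d"
  proof (rule mult_right_mono[OF _ d0])
    have "k powr (3 / 2) = k powr (1 + 1 / 2)" by simp
    also have "\<dots> = k * sqrt k"
      using k by (simp only: powr_add powr_half_sqrt) simp
    finally have p: "k powr (3 / 2) = k * sqrt k" .
    have "1 * 1 \<le> k * sqrt k"
      using k by (intro mult_mono) auto
    then have "\<delta> / 2 * (k * sqrt k) * (2 + k) * 2 \<le> \<delta> / 2 * (k * sqrt k) * (2 + k) * (1 + k * sqrt k)"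
      using k f.\<delta> by (intro mult_left_mono) auto
    moreover have "delta_lhs \<delta> = \<delta> / 2 * (k * sqrt k) * (2 + k) * (1 + k * sqrt k)"
      by (simp add: delta_lhs_def k_def[symmetric] p)
    ultimately show "\<delta> * (k * sqrt k) * (2 + k) \<le> delta_lhs \<delta>" by simp
  qed
  finally show ?thesis .
qed

text \<open>
  Banach's theorem is applied to continuous functions from the whole line to \<open>[0, 1]\<close>. A function on the
  half-line is made into one by \<open>clamp\<close>, which continues it by its value at 0; \<open>profile\<close> sees only
  non-negative arguments, so this does not interfere with the fixed point equation.
\<close>

lemma ex1_profile_fixed_point:
  assumes "0 < \<delta>" "\<delta> < delta1"
  shows "\<exists>y. bounded_conductivity \<delta> y \<and> (\<forall>x\<ge>0. y x = profile \<delta> y x) \<and>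
    (\<forall>z. bounded_conductivity \<delta> z \<longrightarrow> (\<forall>x\<ge>0. z x = profile \<delta> z x) \<longrightarrow> (\<forall>x\<ge>0. z x = y x))"
proof -
  define S :: "(real \<Rightarrow>\<^sub>C real) set" where "S = PiC UNIV (\<lambda>_. {0..1})"
  define clamp where "clamp h = (\<lambda>x. h (max 0 x))" for h :: "real \<Rightarrow> real"
  define T where "T f = Bcontfun (clamp (profile \<delta> (apply_bcontfun f)))" for f
  have clamp: "clamp h \<in> bcontfun" if h: "continuous_on {0..} h" "\<And>x. 0 \<le> x \<Longrightarrow> h x \<in> {0..1}" for h
  proof -
    have "continuous_on UNIV (clamp h)"
      unfolding clamp_def
      by (intro continuous_on_compose2[OF h(1)] continuous_intros) auto
    moreover have "range (clamp h) \<subseteq> {0..1}"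
      using h(2) by (force simp: clamp_def)
    ultimately show ?thesis
      by (auto simp: bcontfun_def intro: bounded_subset[OF bounded_closed_interval])
  qed
  have adm: "bounded_conductivity \<delta> (apply_bcontfun f)" if "f \<in> S" for f
    using that assms by unfold_locales (auto simp: S_def mem_PiC_iff)
  have cont: "continuous_on {0..} (profile \<delta> h)" if "bounded_conductivity \<delta> h" for h
    by (rule DERIV_continuous_on) (use bounded_conductivity.profile_deriv[OF that] in auto)
  have T_apply: "apply_bcontfun (T f) = clamp (profile \<delta> (apply_bcontfun f))" if "f \<in> S" for f
    unfolding T_def
    using bounded_conductivity.profile_bounds[OF adm[OF that]]
    by (intro Bcontfun_inverse clamp cont adm that) auto
  have "\<exists>!f\<in>S. T f = f"
  proof (rule Banach_fix)
    show "complete S"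
      unfolding S_def complete_eq_closed by (intro closed_PiC) auto
    have "const_bcontfun 0 \<in> S"
      by (simp add: S_def mem_PiC_iff const_bcontfun.rep_eq)
    then show "S \<noteq> {}" by blast
    show "0 \<le> delta_lhs \<delta>" "delta_lhs \<delta> < 1"
      using delta_lhs_strict_mono[of \<delta> delta1] delta1 assms by (auto simp: delta_lhs_def)
    show "T ` S \<subseteq> S"
      using bounded_conductivity.profile_bounds[OF adm]
      by (auto simp: S_def mem_PiC_iff T_apply[unfolded S_def mem_PiC_iff] clamp_def)
    show "dist (T f) (T g) \<le> delta_lhs \<delta> * dist f g" if "f \<in> S" "g \<in> S" for f g
    proof (rule dist_bound)
      fix x
      show "dist (T f x) (T g x) \<le> delta_lhs \<delta> * dist f g"
        using that profile_contraction[OF adm adm, of f g "dist f g" "max 0 x"] dist_bounded[of f _ g]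
        by (simp add: T_apply clamp_def dist_real_def)
    qed
  qed
  then obtain y where y: "y \<in> S" "T y = y" and unique: "\<And>f. f \<in> S \<Longrightarrow> T f = f \<Longrightarrow> f = y"
    by blast
  have "z x = y x" if z: "bounded_conductivity \<delta> z" and fp: "\<And>x. 0 \<le> x \<Longrightarrow> z x = profile \<delta> z x"
    and x: "0 \<le> x" for z x
  proof -
    interpret z: bounded_conductivity \<delta> z by fact
    have z': "apply_bcontfun (Bcontfun (clamp z)) = clamp z"
      using z.nonneg z.le_1 by (intro Bcontfun_inverse clamp z.cont) auto
    have S: "Bcontfun (clamp z) \<in> S"
      using z.nonneg z.le_1 by (auto simp: S_def mem_PiC_iff z') (auto simp: clamp_def)
    have slope: "slope \<delta> (clamp z) t = slope \<delta> z t" if "0 \<le> t" for t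
      unfolding slope_def decay_def using that
      by (auto simp: clamp_def intro!: arg_cong[where f = exp] arg_cong2[where f = "(/)"]
          Henstock_Kurzweil_Integration.integral_cong)
    have "profile \<delta> (clamp z) t = profile \<delta> z t" for t
      unfolding profile_def
      by (intro arg_cong2[where f = "(/)"] Henstock_Kurzweil_Integration.integral_cong slope) auto
    then have "T (Bcontfun (clamp z)) = Bcontfun (clamp z)"
      using fp by (intro bcontfun_eqI) (simp add: T_apply S z', simp add: clamp_def)
    from unique[OF S this] show ?thesis
      using x z' by (auto simp: clamp_def)
  qed
  moreover have "y x = profile \<delta> y x" if "0 \<le> x" for x
    using fun_cong[OF T_apply[OF y(1)], of x] y(2) that by (simp add: clamp_def)
  ultimately show ?thesis
    using adm[OF y(1)] by blast
qed

section \<open>The boundary value problem as a fixed point equation\<close>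

text \<open>
  The quotient of the flux and \<open>decay \<delta> f\<close> has derivative 0 on the open half-line, hence is a constant
  \<open>C\<close>. Then \<open>f' = C slope \<delta> f\<close> there, and continuity of \<open>f\<close> at 0 allows integrating from 0.
\<close>

lemma (in conductivity) solution_eq_integral_slope:
  assumes f: "solves_bvp \<delta> f"
  obtains C where "\<And>x. 0 \<le> x \<Longrightarrow> f x = C * integral {0..x} (slope \<delta> f)"
proof -
  define W where "W x = (1 + \<delta> * f x) * deriv f x" for x
  have at: "at x within {0..} = at x" if "0 < x" for x :: real
    using that by (simp add: at_within_interior[of x "{0..}"])
  have W_deriv: "(W has_real_derivative - 2 * x * deriv f x) (at x)" if "0 < x" for x
  proof -
    have "(W has_real_derivative deriv W x) (at x)"
      using f that unfolding solves_bvp_def W_def DERIV_deriv_iff_real_differentiable by blast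
    moreover have "deriv W x + 2 * x * deriv f x = 0"
      using f that unfolding solves_bvp_def W_def by blast
    ultimately show ?thesis
      by (simp add: add_eq_0_iff2)
  qed
  have "((\<lambda>x. W x / decay \<delta> f x) has_real_derivative 0) (at x)" if "0 < x" for x
    using DERIV_divide[OF W_deriv[OF that] decay_deriv[of x, unfolded at[OF that]]] that
      conductivity_pos[of x] decay_pos[of x]
    by (simp add: W_def)
  then have "\<exists>C. \<forall>x\<in>{0<..}. W x / decay \<delta> f x = C"
    by (intro has_field_derivative_zero_constant) (auto intro: has_field_derivative_at_within)
  then obtain C where C: "\<And>x. 0 < x \<Longrightarrow> W x / decay \<delta> f x = C"
    by auto
  have W: "W x = C * decay \<delta> f x" if "0 < x" for x
    using C[OF that] decay_pos[of x] by (simp add: field_simps)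
  have f_deriv: "(f has_real_derivative C * slope \<delta> f x) (at x)" if "0 < x" for x
  proof -
    have "(f has_real_derivative deriv f x) (at x)"
      using f that by (simp add: solves_bvp_def DERIV_deriv_iff_real_differentiable)
    moreover have "deriv f x = C * slope \<delta> f x"
      using W[OF that] conductivity_pos[of x] that by (simp add: W_def slope_def field_simps)
    ultimately show ?thesis by simp
  qed
  define q where "q x = f x - C * integral {0..x} (slope \<delta> f)" for x
  have q_deriv: "(q has_real_derivative 0) (at x)" if "0 < x" for x
    using DERIV_diff[OF f_deriv[OF that] DERIV_cmult[OF
        has_real_derivative_integral_halfline[OF continuous_on_slope, of x, unfolded at[OF that]], of C]] that
    by (simp add: q_def[abs_def])
  have q_cont: "continuous_on {0..} q"
    unfolding q_def
    by (intro continuous_intros cont DERIV_continuous_on[OF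
          has_real_derivative_integral_halfline[OF continuous_on_slope]]) auto
  have "f x = C * integral {0..x} (slope \<delta> f)" if "0 \<le> x" for x
  proof (cases "x = 0")
    case True
    then show ?thesis using f by (simp add: solves_bvp_def)
  next
    case False
    then have "q x = q 0"
      using that q_deriv by (intro DERIV_isconst_end continuous_on_subset[OF q_cont]) auto
    then show ?thesis using f by (simp add: q_def solves_bvp_def)
  qed
  then show ?thesis by (rule that)
qed

text \<open>
  In the representation \<open>f = C \<integral> slope\<close> the limit 1 forces \<open>C > 0\<close>. So \<open>f\<close> is increasing and bounded by its
  limit; this bound makes the slope integrable on the half-line, and the limit then gives
  \<open>C = 1 / \<integral> slope\<close>.
\<close>

lemma (in conductivity) solution_is_fixed_point:
  assumes f: "solves_bvp \<delta> f"
  shows "bounded_conductivity \<delta> f" and "\<And>x. 0 \<le> x \<Longrightarrow> f x = profile \<delta> f x"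
proof -
  let ?A = "\<lambda>x. integral {0..x} (slope \<delta> f)"
  obtain C where C: "\<And>x. 0 \<le> x \<Longrightarrow> f x = C * ?A x"
    using solution_eq_integral_slope[OF f] by blast
  have lim: "(f \<longlongrightarrow> 1) at_top"
    using f by (simp add: solves_bvp_def)
  have "0 < C"
  proof (rule ccontr)
    assume "\<not> 0 < C"
    then have "f x \<le> 0" if "0 \<le> x" for x
      using integral_slope_mono[of 0 x] that unfolding C[OF that] by (intro mult_nonpos_nonneg) auto
    then have "eventually (\<lambda>x. f x \<le> 0) at_top"
      by (rule eventually_at_top_linorderI)
    from tendsto_upperbound[OF lim this] show False by simp
  qed
  have "f x \<le> 1" if "0 \<le> x" for x
  proof (rule tendsto_lowerbound[OF lim])
    show "eventually (\<lambda>t. f x \<le> f t) at_top"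
    proof (rule eventually_at_top_linorderI)
      fix t assume "x \<le> t"
      with that \<open>0 < C\<close> show "f x \<le> f t"
        by (subst (1 2) C) (auto intro!: mult_left_mono integral_slope_mono)
    qed
  qed auto
  then show bounded: "bounded_conductivity \<delta> f"
    by unfold_locales
  interpret bounded_conductivity \<delta> f by fact
  have "((\<lambda>x. C * integral {0..} (slope \<delta> f) * profile \<delta> f x) \<longlongrightarrow>
      C * integral {0..} (slope \<delta> f) * 1) at_top"
    by (intro tendsto_intros profile_tendsto)
  moreover have "eventually (\<lambda>x. f x = C * integral {0..} (slope \<delta> f) * profile \<delta> f x) at_top"
    using C integral_slope_pos
    by (intro eventually_at_top_linorderI[of 0]) (simp add: profile_def)
  ultimately have "C * integral {0..} (slope \<delta> f) = 1"
    using tendsto_unique[OF _ lim] tendsto_cong by fastforce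
  then show "f x = profile \<delta> f x" if "0 \<le> x" for x
    using C[OF that] integral_slope_pos by (simp add: profile_def field_simps)
qed

context bounded_conductivity
begin

context
  assumes fixed_point: "\<And>x. 0 \<le> x \<Longrightarrow> f x = profile \<delta> f x"
begin

lemma fixed_point_deriv:
  assumes "0 \<le> x"
  shows "(f has_real_derivative slope \<delta> f x / integral {0..} (slope \<delta> f)) (at x within {0..})"
  using profile_deriv[OF assms]
  by (rule has_field_derivative_transform_within[OF _ zero_less_one]) (use assms fixed_point in auto)

lemma fixed_point_solves_bvp: "solves_bvp \<delta> f"
proof -
  define b where "b = integral {0..} (slope \<delta> f)"
  have b: "0 < b" unfolding b_def by (rule integral_slope_pos)
  have at: "at x within {0..} = at x" if "0 < x" for x :: real
    using that by (simp add: at_within_interior[of x "{0..}"])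
  have f_deriv: "(f has_real_derivative slope \<delta> f x / b) (at x)" if "0 < x" for x
    using fixed_point_deriv[of x] that by (simp add: at b_def)
  then have deriv_f: "deriv f x = slope \<delta> f x / b" if "0 < x" for x
    using that DERIV_imp_deriv by blast
  have flux_deriv: "((\<lambda>t. (1 + \<delta> * f t) * deriv f t) has_real_derivative - (2 * x * deriv f x)) (at x)"
    if "0 < x" for x
  proof (rule has_field_derivative_transform_within_open[of "\<lambda>t. decay \<delta> f t / b" _ _ "{0<..}"])
    show "((\<lambda>t. decay \<delta> f t / b) has_real_derivative - (2 * x * deriv f x)) (at x)"
      using DERIV_cdivide[OF decay_deriv[of x, unfolded at[OF that]], of b] that
      by (simp add: deriv_f slope_def)
    show "decay \<delta> f t / b = (1 + \<delta> * f t) * deriv f t" if "t \<in> {0<..}" for t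
      using that conductivity_pos[of t] by (simp add: deriv_f slope_def)
  qed (use that in auto)
  have "(f \<longlongrightarrow> 1) at_top"
    using profile_tendsto
    by (rule Lim_transform_eventually) (use fixed_point in \<open>auto intro!: eventually_at_top_linorderI[of 0]\<close>)
  moreover have "f 0 = 0"
    using fixed_point[of 0] by (simp add: profile_def)
  ultimately show ?thesis
    unfolding solves_bvp_def
    using f_deriv flux_deriv DERIV_imp_deriv[OF flux_deriv]
    by (auto simp: real_differentiable_def)
qed

text \<open>
  With \<open>p = 1 + \<delta> f\<close> and \<open>t = f' / p\<close>, which is \<open>decay \<delta> f / (b p\<^sup>2)\<close>, one has
  \<open>f' = t + \<delta> f t\<close>, \<open>(1 / p)' = - \<delta> (1 / p) t\<close>, \<open>(x / p)' = 1 / p - \<delta> (x / p) t\<close> and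
  \<open>t' = - 2 (x / p) t - 2 \<delta> t\<^sup>2\<close>. A constant component 1 turns the linear terms into
  quadratic ones.
\<close>

lemma fixed_point_analytic: "real_analytic_on f {0..}"
proof -
  define b where "b = integral {0..} (slope \<delta> f)"
  have b: "0 < b" unfolding b_def by (rule integral_slope_pos)
  define p where "p x = 1 + \<delta> * f x" for x
  define t where "t x = decay \<delta> f x / (b * (p x)\<^sup>2)" for x
  define Q :: "real \<times> real \<times> real \<times> real \<times> real \<Rightarrow> real \<times> real \<times> real \<times> real \<times> real \<Rightarrow>
      real \<times> real \<times> real \<times> real \<times> real"
    where "Q = (\<lambda>(c, y, r, v, s) (c', y', r', v', s').
      (0, c * s' + \<delta> * y * s', - \<delta> * r * s', c * r' - \<delta> * v * s', - 2 * v * s' - 2 * \<delta> * s * s'))"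
  define F where "F x = (1::real, f x, 1 / p x, x / p x, t x)" for x
  have "bilinear Q"
    unfolding bilinear_def linear_iff Q_def by (auto simp: algebra_simps)
  then have "bounded_bilinear Q"
    by (simp add: bilinear_conv_bounded_bilinear)
  moreover have "(F has_vector_derivative Q (F x) (F x)) (at x within {0..})" if "x \<in> {0..}" for x
  proof -
    have p: "0 < p x" using conductivity_pos[of x] that by (simp add: p_def)
    have f': "(f has_real_derivative t x * p x) (at x within {0..})"
      using fixed_point_deriv[of x] that p
      by (simp add: b_def[symmetric] t_def slope_def p_def[symmetric] power2_eq_square mult.commute)
    have p': "(p has_real_derivative \<delta> * (t x * p x)) (at x within {0..})"
      unfolding p_def[abs_def] by (rule derivative_eq_intros f'[unfolded p_def] refl | simp)+
    have r': "((\<lambda>x. 1 / p x) has_real_derivative - \<delta> * (1 / p x) * t x) (at x within {0..})"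
      by (rule derivative_eq_intros p' refl | use p in \<open>simp add: field_simps\<close>)+
    have v': "((\<lambda>x. x / p x) has_real_derivative 1 / p x - \<delta> * (x / p x) * t x) (at x within {0..})"
      by (rule derivative_eq_intros p' refl | use p in \<open>simp add: field_simps\<close>)+
    have t': "(t has_real_derivative - 2 * (x / p x) * t x - 2 * \<delta> * t x * t x) (at x within {0..})"
    proof -
      have "(decay \<delta> f has_real_derivative - (2 * (x / p x)) * decay \<delta> f x) (at x within {0..})"
        using decay_deriv[of x] that by (simp add: p_def)
      moreover have "decay \<delta> f x = t x * b * (p x)\<^sup>2"
        using b p by (simp add: t_def)
      ultimately have "(t has_real_derivative
          (- (2 * (x / p x)) * decay \<delta> f x * (b * (p x)\<^sup>2) - decay \<delta> f x * (b * (2 * p x * (\<delta> * (t x * p x)))))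
          / (b * (p x)\<^sup>2 * (b * (p x)\<^sup>2))) (at x within {0..})"
        unfolding t_def[abs_def] using p b
        by (auto intro!: derivative_eq_intros p' simp: t_def)
      also have "(- (2 * (x / p x)) * decay \<delta> f x * (b * (p x)\<^sup>2) - decay \<delta> f x * (b * (2 * p x * (\<delta> * (t x * p x)))))
          / (b * (p x)\<^sup>2 * (b * (p x)\<^sup>2)) = - 2 * (x / p x) * t x - 2 * \<delta> * t x * t x"
        unfolding t_def using p b by (simp add: field_simps power2_eq_square)
      finally show ?thesis .
    qed
    have "(F has_vector_derivative (0, t x * p x, - \<delta> * (1 / p x) * t x,
        1 / p x - \<delta> * (x / p x) * t x, - 2 * (x / p x) * t x - 2 * \<delta> * t x * t x)) (at x within {0..})"
      unfolding F_def
      by (intro has_vector_derivative_Pair f' r' v' t' has_vector_derivative_const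
          has_real_derivative_iff_has_vector_derivative[THEN iffD1])
    also have "(0, t x * p x, - \<delta> * (1 / p x) * t x,
        1 / p x - \<delta> * (x / p x) * t x, - 2 * (x / p x) * t x - 2 * \<delta> * t x * t x) = Q (F x) (F x)"
      by (simp add: F_def Q_def p_def algebra_simps)
    finally show ?thesis .
  qed
  ultimately have "real_analytic_on (\<lambda>x. fst (snd (F x))) {0..}"
    by (intro real_analytic_on_quadratic_ode[of Q "\<lambda>x. fst (snd x)"]
        bounded_linear_fst_comp bounded_linear_snd) auto
  then show ?thesis by (simp add: F_def)
qed

end

end

theorem corollary2p2:
  fixes \<delta> :: real
  assumes "0 < \<delta>" and "\<delta> < delta1"
  shows "\<exists>y. nonneg_analytic_solution \<delta> y \<and>
           (\<forall>z. nonneg_analytic_solution \<delta> z \<longrightarrow> (\<forall>x\<ge>0. z x = y x))"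
proof -
  obtain y where y: "bounded_conductivity \<delta> y" "\<And>x. 0 \<le> x \<Longrightarrow> y x = profile \<delta> y x"
    and unique: "\<And>z x. bounded_conductivity \<delta> z \<Longrightarrow> (\<And>x. 0 \<le> x \<Longrightarrow> z x = profile \<delta> z x) \<Longrightarrow>
      0 \<le> x \<Longrightarrow> z x = y x"
    using ex1_profile_fixed_point[OF assms] by blast
  interpret bounded_conductivity \<delta> y by fact
  have "nonneg_analytic_solution \<delta> y"
    using fixed_point_solves_bvp[OF y(2)] fixed_point_analytic[OF y(2)] nonneg
    by (simp add: nonneg_analytic_solution_def)
  moreover have "z x = y x" if z: "nonneg_analytic_solution \<delta> z" and "0 \<le> x" for z x
  proof (rule unique)
    interpret z: conductivity \<delta> z
      using z assms
      by unfold_locales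
        (auto simp: nonneg_analytic_solution_def intro: real_analytic_on_imp_continuous_on)
    have z_solves: "solves_bvp \<delta> z"
      using z by (simp add: nonneg_analytic_solution_def)
    show "bounded_conductivity \<delta> z"
      by (rule z.solution_is_fixed_point(1)[OF z_solves])
    show "z t = profile \<delta> z t" if "0 \<le> t" for t
      by (rule z.solution_is_fixed_point(2)[OF z_solves that])
  qed fact
  ultimately show ?thesis by blast
qed

end
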